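(* Let $G=(U,V,E)$ be a finite bipartite graph, $w:E\to\mathbb{R}_{\ge 0}$ and $b:U\cup V\to\mathbb{Z}_{\ge 0}$, defining an unconstrained bipartite $b$-matching game. Let $(u,v)\in\mathbb{R}^U\times\mathbb{R}^V$ be an optimal solution to the linear program $$\min \sum_{i\in U}b_iu_i+\sum_{j\in V}b_jv_j\quad\text{s.t.}\quad u_i+v_j\ge w_{ij}\ \ \forall (i,j)\in E,\quad u_i\ge 0\ \ \forall i\in U,\quad v_j\ge 0\ \ \forall j\in V.$$ Then the profit-sharing method $(\alpha,\beta)$ defined by $\alpha_i=b_i u_i$ for $i\in U$ and $\beta_j=b_jv_j$ for $j\in V$ is an imputation in the core of the unconstrained bipartite $b$-matching game.
   Context: Unconstrained bipartite $b$-matching game: the players are the vertices $U\cup V$. An (unconstrained) $b$-matching assigns to each edge a non-negative integer multiplicity $x_{ij}$ so that the total multiplicity of edges at each vertex $q$ is at most $b_q$ (edges may be matched multiple times); its weight is $\sum_{(i,j)}w_{ij}x_{ij}$. The worth $p(S_u\cup S_v)$ of a coalition $S_u\cup S_v$ ($S_u\subseteq U,S_v\subseteq V$) is the weight of a maximum weight such $b$-matching in the subgraph of $G$ induced on $S_u\cup S_v$. An imputation is a pair of functions $\alpha:U\to\mathbb{R}_{\ge 0}$, $\beta:V\to\mathbb{R}_{\ge 0}$ with $\sum_{i\in U}\alpha_i+\sum_{j\in V}\beta_j=p(U\cup V)$. It is in the core if $\sum_{i\in S_u}\alpha_i+\sum_{j\in S_v}\beta_j\ge p(S_u\cup S_v)$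 for every coalition $S_u\cup S_v$. *)

theory Defs
  imports Complex_Main
begin

(* Both sides live in one vertex type, with U and V disjoint, so that b is a single function
   on U \<union> V; an edge is an ordered pair with its first end in U and its second end in V. *)
definition bipartite_graph :: "'a set \<Rightarrow> 'a set \<Rightarrow> ('a \<times> 'a) set \<Rightarrow> bool" where
  "bipartite_graph U V E \<longleftrightarrow> finite U \<and> finite V \<and> U \<inter> V = {} \<and> E \<subseteq> U \<times> V"

definition induced_edges :: "('a \<times> 'a) set \<Rightarrow> 'a set \<Rightarrow> ('a \<times> 'a) set" where
  "induced_edges E S = {(i, j) \<in> E. i \<in> S \<and> j \<in> S}"

(* Multiplicities are total functions on pairs, made canonical by vanishing off the edge set. *)
definition b_matching :: "'a set \<Rightarrow> ('a \<times> 'a) set \<Rightarrow> ('a \<Rightarrow> nat) \<Rightarrow> ('a \<times> 'a \<Rightarrow> nat) \<Rightarrow> bool" where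
  "b_matching S E b x \<longleftrightarrow>
     (\<forall>e. e \<notin> E \<longrightarrow> x e = 0) \<and>
     (\<forall>q\<in>S. (\<Sum>e\<in>{e \<in> E. fst e = q \<or> snd e = q}. x e) \<le> b q)"

definition matching_weight ::
  "('a \<times> 'a) set \<Rightarrow> ('a \<times> 'a \<Rightarrow> real) \<Rightarrow> ('a \<times> 'a \<Rightarrow> nat) \<Rightarrow> real" where
  "matching_weight E w x = (\<Sum>e\<in>E. w e * real (x e))"

(* The maximum is over a finite nonempty set, see finite_b_matchings and b_matching_zero. *)
definition worth ::
  "('a \<times> 'a) set \<Rightarrow> ('a \<times> 'a \<Rightarrow> real) \<Rightarrow> ('a \<Rightarrow> nat) \<Rightarrow> 'a set \<Rightarrow> real" where
  "worth E w b S =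
     Max {matching_weight (induced_edges E S) w x | x. b_matching S (induced_edges E S) b x}"

definition imputation ::
  "'a set \<Rightarrow> 'a set \<Rightarrow> ('a set \<Rightarrow> real) \<Rightarrow> ('a \<Rightarrow> real) \<Rightarrow> ('a \<Rightarrow> real) \<Rightarrow> bool" where
  "imputation U V p \<alpha> \<beta> \<longleftrightarrow>
     (\<forall>i\<in>U. 0 \<le> \<alpha> i) \<and> (\<forall>j\<in>V. 0 \<le> \<beta> j) \<and>
     (\<Sum>i\<in>U. \<alpha> i) + (\<Sum>j\<in>V. \<beta> j) = p (U \<union> V)"

definition in_core ::
  "'a set \<Rightarrow> 'a set \<Rightarrow> ('a set \<Rightarrow> real) \<Rightarrow> ('a \<Rightarrow> real) \<Rightarrow> ('a \<Rightarrow> real) \<Rightarrow> bool" where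
  "in_core U V p \<alpha> \<beta> \<longleftrightarrow>
     imputation U V p \<alpha> \<beta> \<and>
     (\<forall>Su Sv. Su \<subseteq> U \<and> Sv \<subseteq> V \<longrightarrow> p (Su \<union> Sv) \<le> (\<Sum>i\<in>Su. \<alpha> i) + (\<Sum>j\<in>Sv. \<beta> j))"

definition lp_feasible ::
  "'a set \<Rightarrow> 'a set \<Rightarrow> ('a \<times> 'a) set \<Rightarrow> ('a \<times> 'a \<Rightarrow> real) \<Rightarrow> ('a \<Rightarrow> real) \<times> ('a \<Rightarrow> real) \<Rightarrow> bool" where
  "lp_feasible U V E w = (\<lambda>(u, v).
     (\<forall>(i, j)\<in>E. w (i, j) \<le> u i + v j) \<and> (\<forall>i\<in>U. 0 \<le> u i) \<and> (\<forall>j\<in>V. 0 \<le> v j))"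

definition lp_objective ::
  "'a set \<Rightarrow> 'a set \<Rightarrow> ('a \<Rightarrow> nat) \<Rightarrow> ('a \<Rightarrow> real) \<times> ('a \<Rightarrow> real) \<Rightarrow> real" where
  "lp_objective U V b = (\<lambda>(u, v).
     (\<Sum>i\<in>U. real (b i) * u i) + (\<Sum>j\<in>V. real (b j) * v j))"

lemma b_matching_zero: "b_matching S E b (\<lambda>_. 0)"
  by (simp add: b_matching_def)

lemma finite_b_matchings:
  assumes "bipartite_graph U V E" "S \<subseteq> U \<union> V"
  shows "finite {x. b_matching S (induced_edges E S) b x}"
proof -
  let ?F = "induced_edges E S"
  have finE: "finite E"
    using assms(1) unfolding bipartite_graph_def by (meson finite_SigmaI finite_subset)
  have finF: "finite ?F"
    using finE by (rule finite_subset[rotated]) (auto simp: induced_edges_def)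
  have finS: "finite S"
    using assms unfolding bipartite_graph_def by (meson finite_UnI finite_subset)
  have le: "x e \<le> (\<Sum>q\<in>S. b q)" if x: "b_matching S ?F b x" and e: "e \<in> ?F" for x e
  proof -
    have q: "fst e \<in> S" using e by (auto simp: induced_edges_def)
    have "x e \<le> (\<Sum>e'\<in>{e' \<in> ?F. fst e' = fst e \<or> snd e' = fst e}. x e')"
      using finF e by (intro member_le_sum) auto
    also have "\<dots> \<le> b (fst e)"
      using x q by (auto simp: b_matching_def)
    also have "\<dots> \<le> (\<Sum>q\<in>S. b q)"
      using finS q by (intro member_le_sum) auto
    finally show ?thesis .
  qed
  have "{x. b_matching S ?F b x} \<subseteq>
      {x. \<forall>e. (e \<in> ?F \<longrightarrow> x e \<in> {..(\<Sum>q\<in>S. b q)}) \<and> (e \<notin> ?F \<longrightarrow> x e = 0)}"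
    using le by (auto simp: b_matching_def)
  then show ?thesis
    by (rule finite_subset) (rule finite_set_of_finite_funs[OF finF], simp)
qed

end

theory Submission
  imports Defs
begin

text \<open>
  By weak duality it suffices to find an integral b-matching that is complementary slack to the
  optimal dual \<open>(u, v)\<close>: supported on the tight edges and saturating every vertex of positive price.
  Optimality of \<open>(u, v)\<close> gives a Hall condition on each side: if some set \<open>R\<close> of positively priced
  vertices had tight neighbourhood of smaller total capacity, shifting a small amount of price from
  \<open>R\<close> to its neighbourhood would decrease the objective. Under the Hall condition, any b-matching on
  tight edges that leaves a positively priced vertex unsaturated can be improved by an alternating
  walk, so one of maximal total degree on the positively priced vertices is complementary slack.
\<close>

section \<open>Vertex degrees, reversal of the graph, and double counting\<close>

definition degree :: "('a \<times> 'a) set \<Rightarrow> ('a \<times> 'a \<Rightarrow> nat) \<Rightarrow> 'a \<Rightarrow> nat" where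
  "degree T x q = (\<Sum>e\<in>{e \<in> T. fst e = q \<or> snd e = q}. x e)"

lemma b_matching_degree:
  "b_matching S E b x \<longleftrightarrow> (\<forall>e. e \<notin> E \<longrightarrow> x e = 0) \<and> (\<forall>q\<in>S. degree E x q \<le> b q)"
  by (simp add: b_matching_def degree_def)

lemma bipartite_graph_finite: "bipartite_graph U V E \<Longrightarrow> finite E"
  unfolding bipartite_graph_def by (meson finite_SigmaI finite_subset)

lemma bipartite_graph_converse: "bipartite_graph U V E \<Longrightarrow> bipartite_graph V U (E\<inverse>)"
  unfolding bipartite_graph_def by auto

text \<open>The replaced and the new multiplicity sit on opposite sides of the equation, which
  avoids truncated subtraction on \<open>nat\<close>.\<close>

lemma degree_upd:
  assumes "finite T" "e \<in> T"
  shows "degree T (x(e := n)) p + (if p = fst e \<or> p = snd e then x e else 0)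
    = degree T x p + (if p = fst e \<or> p = snd e then n else 0)"
proof (cases "p = fst e \<or> p = snd e")
  case True
  let ?D = "{e \<in> T. fst e = p \<or> snd e = p}"
  have D: "finite ?D" "e \<in> ?D" using assms True by auto
  have "sum (x(e := n)) (?D - {e}) = sum x (?D - {e})"
    by (rule sum.cong) auto
  then show ?thesis
    using True sum.remove[OF D, of x] sum.remove[OF D, of "x(e := n)"]
    by (simp add: degree_def)
next
  case False
  then have "degree T (x(e := n)) p = degree T x p"
    unfolding degree_def by (intro sum.cong) auto
  with False show ?thesis by simp
qed

text \<open>Reversing all edges exchanges the two sides of the graph, so arguments given for left
  vertices carry over to right vertices.\<close>

lemma degree_converse: "degree (T\<inverse>) (x \<circ> prod.swap) q = degree T x q"
  unfolding degree_def
  by (rule sum.reindex_bij_witness[of _ prod.swap prod.swap]) auto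

lemma b_matching_converse:
  "b_matching S (T\<inverse>) b (x \<circ> prod.swap) \<longleftrightarrow> b_matching S T b x"
  by (auto simp: b_matching_degree degree_converse)

lemma degree_superset:
  assumes "finite E" "T \<subseteq> E" "\<And>e. e \<notin> T \<Longrightarrow> x e = 0"
  shows "degree E x q = degree T x q"
proof -
  have "\<forall>e\<in>{e \<in> E. fst e = q \<or> snd e = q} - {e \<in> T. fst e = q \<or> snd e = q}. x e = 0"
    using assms(3) by blast
  then show ?thesis
    unfolding degree_def using assms(1,2) by (intro sum.mono_neutral_right) auto
qed

lemma degree_left:
  "bipartite_graph A B T \<Longrightarrow> i \<in> A \<Longrightarrow> degree T x i = sum x {e \<in> T. fst e = i}"
  unfolding degree_def bipartite_graph_def by (intro sum.cong) auto

lemma degree_right: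
  "bipartite_graph A B T \<Longrightarrow> j \<in> B \<Longrightarrow> degree T x j = sum x {e \<in> T. snd e = j}"
  unfolding degree_def bipartite_graph_def by (intro sum.cong) auto

text \<open>Double counting: every edge has exactly one end in \<open>A\<close>, so an edge leaving
  \<open>R\<close> is counted at a single vertex.\<close>

lemma sum_degree_left:
  assumes "bipartite_graph A B T" "R \<subseteq> A"
  shows "(\<Sum>i\<in>R. degree T x i) = sum x {e \<in> T. fst e \<in> R}"
proof -
  have fin: "finite R" "finite {e \<in> T. fst e \<in> R}"
    using assms bipartite_graph_finite[OF assms(1)] unfolding bipartite_graph_def
    by (auto intro: finite_subset)
  have "(\<Sum>i\<in>R. degree T x i) = (\<Sum>i\<in>R. sum x {e \<in> {e \<in> T. fst e \<in> R}. fst e = i})"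
    using assms by (intro sum.cong refl) (auto simp: degree_left intro!: sum.cong)
  also have "\<dots> = sum x {e \<in> T. fst e \<in> R}"
    using fin by (intro sum.group) auto
  finally show ?thesis .
qed

lemma sum_degree_right:
  assumes "bipartite_graph A B T" "S \<subseteq> B"
  shows "(\<Sum>j\<in>S. degree T x j) = sum x {e \<in> T. snd e \<in> S}"
proof -
  have "(\<Sum>j\<in>S. degree T x j) = sum (x \<circ> prod.swap) {e \<in> T\<inverse>. fst e \<in> S}"
    using sum_degree_left[OF bipartite_graph_converse[OF assms(1)] assms(2), of "x \<circ> prod.swap"]
    by (simp add: degree_converse)
  also have "\<dots> = sum x {e \<in> T. snd e \<in> S}"
    by (rule sum.reindex_bij_witness[of _ prod.swap prod.swap]) auto
  finally show ?thesis .
qed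

text \<open>Each unit of an edge pays the prices of both its ends; grouping these payments by vertex
  turns a sum over edges into one shaped like the dual objective.\<close>

lemma sum_price_degree:
  fixes u v :: "'a \<Rightarrow> real"
  assumes "bipartite_graph A B T"
  shows "(\<Sum>e\<in>T. (u (fst e) + v (snd e)) * real (x e))
    = (\<Sum>i\<in>A. real (degree T x i) * u i) + (\<Sum>j\<in>B. real (degree T x j) * v j)"
proof -
  note fin = bipartite_graph_finite[OF assms]
  have AB: "finite A" "finite B" "fst ` T \<subseteq> A" "snd ` T \<subseteq> B"
    using assms unfolding bipartite_graph_def by auto
  have "(\<Sum>i\<in>A. real (degree T x i) * u i)
      = (\<Sum>i\<in>A. \<Sum>e\<in>{e \<in> T. fst e = i}. u (fst e) * real (x e))"
    by (intro sum.cong refl)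
      (auto simp: degree_left[OF assms] sum_distrib_left mult.commute intro!: sum.cong)
  also have "\<dots> = (\<Sum>e\<in>T. u (fst e) * real (x e))"
    using fin AB by (intro sum.group) auto
  finally have 1: "(\<Sum>i\<in>A. real (degree T x i) * u i) = (\<Sum>e\<in>T. u (fst e) * real (x e))" .
  have "(\<Sum>j\<in>B. real (degree T x j) * v j)
      = (\<Sum>j\<in>B. \<Sum>e\<in>{e \<in> T. snd e = j}. v (snd e) * real (x e))"
    by (intro sum.cong refl)
      (auto simp: degree_right[OF assms] sum_distrib_left mult.commute intro!: sum.cong)
  also have "\<dots> = (\<Sum>e\<in>T. v (snd e) * real (x e))"
    using fin AB by (intro sum.group) auto
  finally show ?thesis
    by (simp add: 1 distrib_right sum.distrib)
qed

subsection \<open>Alternating walks\<close>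

text \<open>
  \<open>alternating T x q x' i\<close>: an alternating walk from \<open>q\<close> to \<open>i\<close> turns \<open>x\<close> into \<open>x'\<close>, moving one unit
  of degree from \<open>i\<close> to \<open>q\<close>. The walk may repeat edges, since each step is checked against the
  current multiplicities.
\<close>

inductive alternating ::
  "('a \<times> 'a) set \<Rightarrow> ('a \<times> 'a \<Rightarrow> nat) \<Rightarrow> 'a \<Rightarrow> ('a \<times> 'a \<Rightarrow> nat) \<Rightarrow> 'a \<Rightarrow> bool"
  for T x q where
  start: "alternating T x q x q"
| step: "\<lbrakk>alternating T x q x' i; (i, j) \<in> T; (k, j) \<in> T; x' (k, j) > 0;
    y = x'((i, j) := x' (i, j) + 1)\<rbrakk>
    \<Longrightarrow> alternating T x q (y((k, j) := y (k, j) - 1)) k"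

text \<open>A step adds a unit at \<open>(i, j)\<close> and removes one at \<open>(k, j)\<close>:
  the degree of \<open>j\<close> is unchanged, and the missing unit passes from \<open>i\<close> to
  \<open>k\<close>. For a walk back at \<open>q\<close> the two indicators cancel.\<close>

lemma alternating_degree:
  assumes "alternating T x q x' i" "bipartite_graph A B T"
  shows "degree T x' p + of_bool (p = i) = degree T x p + of_bool (p = q)"
  using assms(1)
proof induction
  case (step x' i j k y)
  note fin = bipartite_graph_finite[OF assms(2)]
  have ne: "i \<noteq> j" "k \<noteq> j"
    using step.hyps assms(2) unfolding bipartite_graph_def by auto
  define z where "z = y((k, j) := y (k, j) - Suc 0)"
  have "y (k, j) > 0" using step.hyps by auto
  moreover have "degree T y p = degree T x' p + (if p = i \<or> p = j then 1 else 0)"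
    using degree_upd[OF fin step.hyps(2), of x' "x' (i, j) + 1" p]
    by (auto simp: step.hyps(5) split: if_splits)
  ultimately have "degree T z p + (if p = k \<or> p = j then 1 else 0)
      = degree T x' p + (if p = i \<or> p = j then 1 else 0)"
    using degree_upd[OF fin step.hyps(3), of y "y (k, j) - 1" p]
    by (auto simp: z_def[symmetric] split: if_splits)
  then have "degree T z p + of_bool (p = k) = degree T x p + of_bool (p = q)"
    using step.IH ne by (auto simp: of_bool_def split: if_splits)
  then show ?case by (simp add: z_def fun_upd_def)
qed simp

lemma alternating_support:
  assumes "alternating T x q x' i" "\<And>e. e \<notin> T \<Longrightarrow> x e = 0" "e \<notin> T"
  shows "x' e = 0"
  using assms by induction auto

lemma alternating_end_left:
  assumes "alternating T x q x' i" "T \<subseteq> A \<times> B" "q \<in> A"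
  shows "i \<in> A"
  using assms by induction auto

text \<open>A multiplicity falls only in a step that ends at the left end of the edge concerned, so
  the walk stopped at that step serves as witness.\<close>

lemma alternating_decrease:
  assumes "alternating T x q x' i" "x' (a, c) < x (a, c)"
  shows "\<exists>x''. alternating T x q x'' a"
  using assms
proof induction
  case (step x' i j k y)
  show ?case
  proof (cases "a = k")
    case True
    then show ?thesis using alternating.step[OF step.hyps] by blast
  next
    case False
    then show ?thesis using step.prems step.IH by (auto simp: step.hyps(5) split: if_splits)
  qed
qed simp

text \<open>Consider the set \<open>R\<close> of vertices where walks from \<open>q\<close> can end.
  Either some walk yields an improvement, or the degrees around \<open>R\<close> violate the Hall
  condition.\<close>

lemma augment_left:
  assumes G: "bipartite_graph A B T"
    and x: "b_matching (A \<union> B) T b x"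
    and hall: "\<And>R. R \<subseteq> A \<inter> P \<Longrightarrow> sum b R \<le> sum b (T `` R)"
    and q: "q \<in> A \<inter> P" "degree T x q < b q"
  obtains x' where "b_matching (A \<union> B) T b x'" "degree T x q < degree T x' q"
    "\<And>p. p \<in> P \<Longrightarrow> degree T x p \<le> degree T x' p"
proof -
  note fin = bipartite_graph_finite[OF G]
  have T: "T \<subseteq> A \<times> B" "finite A" "finite B" "A \<inter> B = {}"
    using G unfolding bipartite_graph_def by auto
  have supp: "x e = 0" if "e \<notin> T" for e
    using x that unfolding b_matching_degree by blast
  have deg: "degree T x p \<le> b p" if "p \<in> A \<union> B" for p
    using x that unfolding b_matching_degree by blast
  define R where "R = {i. \<exists>x'. alternating T x q x' i}"
  have R: "R \<subseteq> A"
    using q T(1) by (auto simp: R_def dest: alternating_end_left)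
  have "q \<in> R" unfolding R_def by (blast intro: alternating.start)
  consider (shift) i where "i \<in> R" "i \<notin> P"
    | (extend) i j where "i \<in> R" "(i, j) \<in> T" "degree T x j < b j"
    | (saturated) "R \<subseteq> P" "\<And>j. j \<in> T `` R \<Longrightarrow> b j \<le> degree T x j"
    using linorder_not_less by blast
  then show thesis
  proof cases
    case shift
    \<comment> \<open>The unit gained by \<open>q\<close> is taken from \<open>i\<close>, whose
      degree may drop because it lies outside \<open>P\<close>; in particular \<open>i\<close>
      differs from \<open>q\<close>.\<close>
    then obtain x' where x': "alternating T x q x' i" by (auto simp: R_def)
    note d = alternating_degree[OF x' G]
    have le: "degree T x' p \<le> b p" if "p \<in> A \<union> B" for p
      using d[of p] deg[OF that] q by (auto simp: of_bool_def split: if_splits)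
    show ?thesis
    proof (rule that)
      show "b_matching (A \<union> B) T b x'"
        using le alternating_support[OF x'] supp by (simp add: b_matching_degree)
      show "degree T x q < degree T x' q"
        using d[of q] shift q by (auto simp: of_bool_def split: if_splits)
      show "degree T x p \<le> degree T x' p" if "p \<in> P" for p
        using d[of p] shift that by (auto simp: of_bool_def split: if_splits)
    qed
  next
    case extend
    then obtain x' where x': "alternating T x q x' i" by (auto simp: R_def)
    note d = alternating_degree[OF x' G]
    \<comment> \<open>One more unit on \<open>(i, j)\<close> repays \<open>i\<close> and uses the
      spare capacity of \<open>j\<close>, so no degree falls below its value under
      \<open>x\<close>.\<close>
    define z where "z = x'((i, j) := x' (i, j) + 1)"
    have "i \<in> A" "j \<in> B" "i \<noteq> j" "q \<noteq> j" using extend(2) T q by auto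
    then have dz: "degree T z p = degree T x p + of_bool (p = q) + of_bool (p = j)" for p
      using degree_upd[OF fin extend(2), of x' "x' (i, j) + 1" p] d[of p]
      by (auto simp: z_def of_bool_def split: if_splits)
    have le: "degree T z p \<le> b p" if "p \<in> A \<union> B" for p
      using dz[of p] deg[OF that] q extend(3) \<open>q \<noteq> j\<close>
      by (auto simp: of_bool_def split: if_splits)
    show ?thesis
    proof (rule that)
      show "b_matching (A \<union> B) T b z"
        using le alternating_support[OF x'] supp extend(2) by (auto simp: b_matching_degree z_def)
    qed (simp_all add: dz)
  next
    case saturated
    txt \<open>If the walk \<open>x'\<close> has already exhausted the edge \<open>(a, j)\<close> of \<open>x\<close>, it has visited \<open>a\<close>.\<close>
    have closed: "a \<in> R" if "j \<in> T `` R" "(a, j) \<in> T" "x (a, j) > 0" for a j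
    proof -
      from that(1) obtain i x' where i: "alternating T x q x' i" "(i, j) \<in> T"
        by (auto simp: R_def)
      show ?thesis
      proof (cases "x' (a, j) > 0")
        case True
        show ?thesis
          using alternating.step[OF i that(2) True refl] unfolding R_def by blast
      next
        case False
        then show ?thesis
          using alternating_decrease[OF i(1), of a j] that(3) by (auto simp: R_def)
      qed
    qed
    \<comment> \<open>The units filling the neighbourhood of \<open>R\<close> all come from
      \<open>R\<close> by \<open>closed\<close>, while \<open>R\<close> has strictly less degree
      than capacity because of \<open>q\<close>.\<close>
    have "sum b (T `` R) \<le> (\<Sum>j\<in>T `` R. degree T x j)"
      using saturated(2) by (intro sum_mono) auto
    also have "\<dots> = sum x {e \<in> T. snd e \<in> T `` R}"
      using T by (intro sum_degree_right[OF G]) auto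
    also have "\<dots> = sum x {e \<in> T. snd e \<in> T `` R \<and> x e > 0}"
      using fin by (intro sum.mono_neutral_right) auto
    also have "\<dots> \<le> sum x {e \<in> T. fst e \<in> R}"
      using fin closed by (intro sum_mono2) (auto, blast)
    also have "\<dots> = (\<Sum>i\<in>R. degree T x i)"
      by (rule sum_degree_left[OF G R, symmetric])
    also have "\<dots> < sum b R"
      using R T(2) q deg \<open>q \<in> R\<close> by (intro sum_strict_mono_ex1) (auto intro: finite_subset)
    finally show ?thesis using hall[of R] R saturated(1) by auto
  qed
qed

text \<open>Degrees are bounded by \<open>b\<close>, so a b-matching of greatest total degree on
  \<open>P\<close> exists; an unsaturated vertex of \<open>P\<close> would allow a further
  increase.\<close>

lemma saturating_b_matching:
  assumes G: "bipartite_graph A B T" and P: "P \<subseteq> A \<union> B"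
    and hallA: "\<And>R. R \<subseteq> A \<inter> P \<Longrightarrow> sum b R \<le> sum b (T `` R)"
    and hallB: "\<And>R. R \<subseteq> B \<inter> P \<Longrightarrow> sum b R \<le> sum b (T\<inverse> `` R)"
  obtains x where "b_matching (A \<union> B) T b x" "\<And>p. p \<in> P \<Longrightarrow> degree T x p = b p"
proof -
  have finP: "finite P"
    using G P unfolding bipartite_graph_def by (auto intro: finite_subset)
  define total where "total x = (\<Sum>p\<in>P. degree T x p)" for x
  have bounded: "\<forall>x. b_matching (A \<union> B) T b x \<longrightarrow> total x < Suc (sum b P)"
    unfolding total_def less_Suc_eq_le
  proof (intro allI impI sum_mono)
    fix x p assume "b_matching (A \<union> B) T b x" "p \<in> P"
    then show "degree T x p \<le> b p" using P unfolding b_matching_degree by blast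
  qed
  obtain x where x: "b_matching (A \<union> B) T b x"
    and max: "\<And>y. b_matching (A \<union> B) T b y \<Longrightarrow> total y \<le> total x"
    using ex_has_greatest_nat[of "b_matching (A \<union> B) T b", OF b_matching_zero bounded] by auto
  show thesis
  proof (rule that[OF x], rule ccontr)
    fix q assume q: "q \<in> P" "degree T x q \<noteq> b q"
    then have lt: "degree T x q < b q"
      using x P by (force simp: b_matching_degree)
    have "\<exists>x'. b_matching (A \<union> B) T b x' \<and> degree T x q < degree T x' q \<and>
      (\<forall>p\<in>P. degree T x p \<le> degree T x' p)"
    proof (cases "q \<in> A")
      case True
      with q have "q \<in> A \<inter> P" by simp
      from augment_left[OF G x hallA this lt] show ?thesis by metis
    next
      case False
      \<comment> \<open>A deficient right vertex is a left vertex of the reversed graph, where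
        \<open>hallB\<close> is the required Hall condition.\<close>
      then have "q \<in> B \<inter> P" using q P by auto
      moreover have "b_matching (B \<union> A) (T\<inverse>) b (x \<circ> prod.swap)"
        using x by (simp add: b_matching_converse Un_commute)
      moreover have "degree (T\<inverse>) (x \<circ> prod.swap) q < b q"
        using lt by (simp add: degree_converse)
      ultimately obtain x' where x': "b_matching (B \<union> A) (T\<inverse>) b x'"
        "degree (T\<inverse>) (x \<circ> prod.swap) q < degree (T\<inverse>) x' q"
        "\<And>p. p \<in> P \<Longrightarrow> degree (T\<inverse>) (x \<circ> prod.swap) p \<le> degree (T\<inverse>) x' p"
        using augment_left[OF bipartite_graph_converse[OF G] _ hallB] by metis
      define z where "z = x' \<circ> prod.swap"
      have "x' = z \<circ> prod.swap" by (auto simp: z_def)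
      with x' show ?thesis
        by (intro exI[of _ z]) (simp add: degree_converse b_matching_converse Un_commute)
    qed
    then obtain x' where x': "b_matching (A \<union> B) T b x'" "degree T x q < degree T x' q"
      "\<forall>p\<in>P. degree T x p \<le> degree T x' p" by blast
    then have "total x < total x'"
      unfolding total_def using finP q by (intro sum_strict_mono_ex1) auto
    with max[OF x'(1)] show False by simp
  qed
qed

subsection \<open>Linear programming duality\<close>

lemma finite_pos_lower_bound:
  fixes F :: "real set"
  assumes "finite F" "\<And>x. x \<in> F \<Longrightarrow> 0 < x"
  obtains d where "0 < d" "\<And>x. x \<in> F \<Longrightarrow> d \<le> x"
  \<comment> \<open>Inserting 1 covers the case of empty \<open>F\<close>.\<close>
  using assms by (intro that[of "Min (insert 1 F)"]) auto

definition tight :: "('a \<times> 'a) set \<Rightarrow> ('a \<times> 'a \<Rightarrow> real) \<Rightarrow> ('a \<Rightarrow> real) \<Rightarrow> ('a \<Rightarrow> real)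
    \<Rightarrow> ('a \<times> 'a) set" where
  "tight E w u v = {(i, j) \<in> E. u i + v j = w (i, j)}"

lemma optimal_imp_hall:
  assumes G: "bipartite_graph U V E"
    and opt: "is_arg_min (lp_objective U V b) (lp_feasible U V E w) (u, v)"
    and R: "R \<subseteq> U" "\<And>i. i \<in> R \<Longrightarrow> 0 < u i"
  shows "sum b R \<le> sum b (tight E w u v `` R)"
proof (rule ccontr)
  let ?S = "tight E w u v `` R"
  assume "\<not> sum b R \<le> sum b ?S"
  then have lt: "real (sum b ?S) < real (sum b R)" unfolding of_nat_less_iff by simp
  have E: "E \<subseteq> U \<times> V" "finite U" "finite V" and S: "?S \<subseteq> V"
    using G unfolding bipartite_graph_def tight_def by auto
  have feas: "\<And>i j. (i, j) \<in> E \<Longrightarrow> w (i, j) \<le> u i + v j" "\<And>i. i \<in> U \<Longrightarrow> 0 \<le> u i"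
    "\<And>j. j \<in> V \<Longrightarrow> 0 \<le> v j"
    using opt by (auto simp: is_arg_min_def lp_feasible_def)
  \<comment> \<open>A shift \<open>d\<close> below every price on \<open>R\<close> and every slack
    of a non-tight edge preserves feasibility; a tight edge at \<open>R\<close> has its other end
    raised by the same \<open>d\<close>.\<close>
  define F where "F = u ` R \<union> (\<lambda>(i, j). u i + v j - w (i, j)) ` (E - tight E w u v)"
  have "finite F"
    using R E bipartite_graph_finite[OF G] by (auto simp: F_def intro: finite_subset)
  moreover have "0 < x" if "x \<in> F" for x
    using that R(2) feas(1) by (force simp: F_def tight_def)
  ultimately obtain d where d: "0 < d" "\<And>x. x \<in> F \<Longrightarrow> d \<le> x"
    using finite_pos_lower_bound[of F] by blast
  have dR: "d \<le> u i" if "i \<in> R" for i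
    using that by (intro d) (auto simp: F_def)
  have dE: "d \<le> u i + v j - w (i, j)" if "(i, j) \<in> E" "(i, j) \<notin> tight E w u v" for i j
    using that by (intro d) (force simp: F_def)
  define u' where "u' i = u i - (if i \<in> R then d else 0)" for i
  define v' where "v' j = v j + (if j \<in> ?S then d else 0)" for j
  have "w (i, j) \<le> u' i + v' j" if "(i, j) \<in> E" for i j
  proof (cases "(i, j) \<in> tight E w u v")
    case True
    then have "i \<in> R \<Longrightarrow> j \<in> ?S" by auto
    then show ?thesis using feas(1)[OF that] d(1) by (auto simp: u'_def v'_def)
  next
    case False
    then show ?thesis using feas(1)[OF that] dE[OF that] d(1) by (auto simp: u'_def v'_def)
  qed
  moreover have "0 \<le> u' i" if "i \<in> U" for i
    using feas(2)[OF that] dR[of i] by (simp add: u'_def)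
  moreover have "0 \<le> v' j" if "j \<in> V" for j
    using feas(3)[OF that] d(1) by (simp add: v'_def)
  ultimately have "lp_feasible U V E w (u', v')"
    by (auto simp: lp_feasible_def)
  then have le: "lp_objective U V b (u, v) \<le> lp_objective U V b (u', v')"
    using opt by (auto simp: is_arg_min_def not_less)
  have "(\<Sum>i\<in>U. real (b i) * u' i)
      = (\<Sum>i\<in>U. real (b i) * u i) - (\<Sum>i\<in>U. if i \<in> R then d * real (b i) else 0)"
    unfolding sum_subtractf[symmetric]
    by (intro sum.cong) (auto simp: u'_def algebra_simps)
  also have "(\<Sum>i\<in>U. if i \<in> R then d * real (b i) else 0) = d * real (sum b R)"
    using R(1) E by (simp add: sum.inter_restrict[symmetric] Int_absorb1 sum_distrib_left)
  finally have 1: "(\<Sum>i\<in>U. real (b i) * u' i) = (\<Sum>i\<in>U. real (b i) * u i) - d * real (sum b R)" .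
  have "(\<Sum>j\<in>V. real (b j) * v' j)
      = (\<Sum>j\<in>V. real (b j) * v j) + (\<Sum>j\<in>V. if j \<in> ?S then d * real (b j) else 0)"
    unfolding sum.distrib[symmetric]
    by (intro sum.cong) (auto simp: v'_def algebra_simps)
  also have "(\<Sum>j\<in>V. if j \<in> ?S then d * real (b j) else 0) = d * real (sum b ?S)"
    using S E by (simp add: sum.inter_restrict[symmetric] Int_absorb1 sum_distrib_left)
  finally have "lp_objective U V b (u', v')
      = lp_objective U V b (u, v) - d * (real (sum b R) - real (sum b ?S))"
    using 1 by (simp add: lp_objective_def algebra_simps)
  moreover have "0 < d * (real (sum b R) - real (sum b ?S))"
    using d(1) lt by (intro mult_pos_pos) auto
  ultimately show False using le by simp
qed

text \<open>The linear program is symmetric in the two sides, so the Hall condition proved for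
  \<open>U\<close> also becomes available for \<open>V\<close>.\<close>

lemma lp_optimal_converse:
  assumes "is_arg_min (lp_objective U V b) (lp_feasible U V E w) (u, v)"
  shows "is_arg_min (lp_objective V U b) (lp_feasible V U (E\<inverse>) (w \<circ> prod.swap)) (v, u)"
proof -
  have feas: "lp_feasible V U (E\<inverse>) (w \<circ> prod.swap) (v', u') \<longleftrightarrow> lp_feasible U V E w (u', v')"
    for u' v' by (auto simp: lp_feasible_def add.commute)
  have obj: "lp_objective V U b (v', u') = lp_objective U V b (u', v')" for u' v'
    by (simp add: lp_objective_def)
  show ?thesis using assms unfolding is_arg_min_def by (auto simp: feas obj)
qed

lemma tight_converse: "tight (E\<inverse>) (w \<circ> prod.swap) v u = (tight E w u v)\<inverse>"
  by (auto simp: tight_def add.commute)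

text \<open>Feasibility bounds each weight by the prices of its ends, and nonnegative prices allow
  degrees to be replaced by capacities. The general \<open>A\<close>, \<open>B\<close>,
  \<open>F\<close> permit use on the subgraph of a coalition.\<close>

lemma weak_duality:
  fixes u v :: "'a \<Rightarrow> real"
  assumes G: "bipartite_graph A B F" and feas: "lp_feasible A B F w (u, v)"
    and x: "b_matching (A \<union> B) F b x"
  shows "matching_weight F w x \<le> (\<Sum>i\<in>A. real (b i) * u i) + (\<Sum>j\<in>B. real (b j) * v j)"
proof -
  have "matching_weight F w x \<le> (\<Sum>e\<in>F. (u (fst e) + v (snd e)) * real (x e))"
    unfolding matching_weight_def using feas
    by (intro sum_mono mult_right_mono) (auto simp: lp_feasible_def)
  also have "\<dots> = (\<Sum>i\<in>A. real (degree F x i) * u i) + (\<Sum>j\<in>B. real (degree F x j) * v j)"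
    by (rule sum_price_degree[OF G])
  also have "\<dots> \<le> (\<Sum>i\<in>A. real (b i) * u i) + (\<Sum>j\<in>B. real (b j) * v j)"
    using x feas
    by (intro add_mono sum_mono mult_right_mono) (auto simp: lp_feasible_def b_matching_degree)
  finally show ?thesis .
qed

text \<open>Complementary slackness turns both inequalities of weak duality into equalities.\<close>

lemma optimal_b_matching:
  assumes G: "bipartite_graph U V E"
    and opt: "is_arg_min (lp_objective U V b) (lp_feasible U V E w) (u, v)"
  obtains x where "b_matching (U \<union> V) E b x"
    "matching_weight E w x = (\<Sum>i\<in>U. real (b i) * u i) + (\<Sum>j\<in>V. real (b j) * v j)"
proof -
  note fin = bipartite_graph_finite[OF G]
  let ?T = "tight E w u v"
  have TE: "?T \<subseteq> E" by (auto simp: tight_def)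
  have GT: "bipartite_graph U V ?T" and disj: "U \<inter> V = {}"
    using G TE unfolding bipartite_graph_def by auto
  define P where "P = {i \<in> U. 0 < u i} \<union> {j \<in> V. 0 < v j}"
  have P: "P \<subseteq> U \<union> V" by (auto simp: P_def)
  have hallU: "sum b R \<le> sum b (?T `` R)" if "R \<subseteq> U \<inter> P" for R
    using that disj by (intro optimal_imp_hall[OF G opt]) (auto simp: P_def)
  have hallV: "sum b R \<le> sum b (?T\<inverse> `` R)" if "R \<subseteq> V \<inter> P" for R
    unfolding tight_converse[symmetric] using that disj
    by (intro optimal_imp_hall[OF bipartite_graph_converse[OF G] lp_optimal_converse[OF opt]])
      (auto simp: P_def)
  obtain x where x: "b_matching (U \<union> V) ?T b x" "\<And>p. p \<in> P \<Longrightarrow> degree ?T x p = b p"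
    using saturating_b_matching[OF GT P hallU hallV] by auto
  have supp: "x e = 0" if "e \<notin> ?T" for e
    using x(1) that unfolding b_matching_degree by blast
  have feas: "\<And>i. i \<in> U \<Longrightarrow> 0 \<le> u i" "\<And>j. j \<in> V \<Longrightarrow> 0 \<le> v j"
    using opt by (auto simp: is_arg_min_def lp_feasible_def)
  have "matching_weight E w x = (\<Sum>e\<in>?T. (u (fst e) + v (snd e)) * real (x e))"
    unfolding matching_weight_def using fin TE supp
    by (intro sum.mono_neutral_cong_right) (auto simp: tight_def)
  also have "\<dots> = (\<Sum>i\<in>U. real (degree ?T x i) * u i) + (\<Sum>j\<in>V. real (degree ?T x j) * v j)"
    by (rule sum_price_degree[OF GT])
  \<comment> \<open>Vertices of \<open>P\<close> are saturated, and all others have price 0, so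
    their degrees do not matter.\<close>
  also have "(\<Sum>i\<in>U. real (degree ?T x i) * u i) = (\<Sum>i\<in>U. real (b i) * u i)"
    using x(2) feas(1) by (intro sum.cong) (force simp: P_def)+
  also have "(\<Sum>j\<in>V. real (degree ?T x j) * v j) = (\<Sum>j\<in>V. real (b j) * v j)"
    using x(2) feas(2) by (intro sum.cong) (force simp: P_def)+
  finally show thesis
    using x(1) TE supp degree_superset[OF fin TE supp]
    by (intro that[of x]) (auto simp: b_matching_degree)
qed

section \<open>Core membership of the dual prices\<close>

theorem theorem10:
  fixes U V :: "'a set" and E :: "('a \<times> 'a) set"
    and w :: "'a \<times> 'a \<Rightarrow> real" and b :: "'a \<Rightarrow> nat"
    and u v :: "'a \<Rightarrow> real"
  assumes "bipartite_graph U V E"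
    and "\<forall>e\<in>E. 0 \<le> w e"
    and "is_arg_min (lp_objective U V b) (lp_feasible U V E w) (u, v)"
  shows "in_core U V (worth E w b) (\<lambda>i. real (b i) * u i) (\<lambda>j. real (b j) * v j)"
proof -
  note G = assms(1) and opt = assms(3)
  have feas: "lp_feasible U V E w (u, v)"
    using opt by (simp add: is_arg_min_def)
  let ?W = "\<lambda>S. {matching_weight (induced_edges E S) w x | x. b_matching S (induced_edges E S) b x}"
  let ?obj = "\<lambda>A B. (\<Sum>i\<in>A. real (b i) * u i) + (\<Sum>j\<in>B. real (b j) * v j)"
  have fin: "finite (?W (A \<union> B))" and bound: "\<And>r. r \<in> ?W (A \<union> B) \<Longrightarrow> r \<le> ?obj A B"
    if "A \<subseteq> U" "B \<subseteq> V" for A B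
  proof -
    have "A \<union> B \<subseteq> U \<union> V" using that by blast
    from finite_b_matchings[OF G this] show "finite (?W (A \<union> B))" by simp
    have "bipartite_graph A B (induced_edges E (A \<union> B))"
      using G that unfolding bipartite_graph_def induced_edges_def
      by (auto intro: finite_subset)
    \<comment> \<open>The same prices are feasible for every coalition, so weak duality bounds its
      worth by its own share.\<close>
    moreover have "lp_feasible A B (induced_edges E (A \<union> B)) w (u, v)"
      using feas that by (auto simp: lp_feasible_def induced_edges_def)
    ultimately show "r \<le> ?obj A B" if "r \<in> ?W (A \<union> B)" for r
      using that weak_duality by blast
  qed
  have "induced_edges E (U \<union> V) = E"
    using G by (auto simp: bipartite_graph_def induced_edges_def)
  then have "?obj U V \<in> ?W (U \<union> V)"
    using optimal_b_matching[OF G opt] by (smt (verit) mem_Collect_eq)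
  then have "worth E w b (U \<union> V) = ?obj U V"
    unfolding worth_def using fin[of U V] bound[of U V] by (intro Max_eqI) simp_all
  moreover have "worth E w b (A \<union> B) \<le> ?obj A B" if "A \<subseteq> U" "B \<subseteq> V" for A B
  proof -
    have "?W (A \<union> B) \<noteq> {}" using b_matching_zero by blast
    then show ?thesis
      unfolding worth_def using fin[OF that] bound[OF that] by (subst Max_le_iff) auto
  qed
  ultimately show ?thesis
    using feas by (simp add: in_core_def imputation_def lp_feasible_def)
qed

end
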